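(* Let $(\mathcal{L},[\cdot,\cdot],\alpha)$ and $(\mathcal{L}',[\cdot,\cdot]',\alpha')$ be multiplicative Hom-Lie algebras over $\mathbb{K}$ and let $\phi:\mathcal{L}\to\mathcal{L}'$ be a Hom-Lie algebra morphism. For $n\ge1$ let $\delta^n:C^n_{HL}(\phi,\phi)\to C^{n+1}_{HL}(\phi,\phi)$ be $$\delta^n(\varphi_1,\varphi_2,\varphi_3)=\big(\delta^n_{HL}\varphi_1,\ \delta^n_{HL}\varphi_2,\ \delta^{n-1}_{HL}\varphi_3+(-1)^{n-1}(\phi\circ\varphi_1-\varphi_2\diamond\phi)\big).$$ Then $\delta^{n+1}\circ\delta^n=0$. Hence $(C^*_{HL}(\phi,\phi),\delta^n)$ is a cohomology complex.
   Context: $\mathbb{K}$ is an algebraically closed field of characteristic $0$. A Hom-Lie algebra $(\mathcal{L},[\cdot,\cdot],\alpha)$ is a vector space with a skew-symmetric bilinear bracket and a linear map $\alpha$ such that $[\alpha(x),[y,z]]+[\alpha(y),[z,x]]+[\alpha(z),[x,y]]=0$; it is multiplicative if $\alpha([x,y])=[\alpha(x),\alpha(y)]$. A Hom-Lie algebra morphism is a linear map $\phi$ with $[\phi(x),\phi(y)]'=\phi([x,y])$ and $\phi\circ\alpha=\alpha'\circ\phi$. For $n\ge1$, $\widetilde{C}^n_{\alpha,\alpha'}(\mathcal{L},\mathcal{L}')$ is the space of skew-symmetric $n$-linear maps $f:\mathcal{L}^{\times n}\to\mathcal{L}'$ with $\alpha'(f(u_1,\dots,u_n))=f(\alpha(u_1),\dots,\alpha(u_n))$,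 and $\widetilde{C}^0_{\alpha,\alpha'}(\mathcal{L},\mathcal{L}')=\mathcal{L}'$. For $n\ge1$, $$\delta^n_{HL}\varphi(x_0,\dots,x_n)=\sum_{i=0}^n(-1)^i[\phi(\alpha^{n-1}(x_i)),\varphi(x_0,\dots,\widehat{x_i},\dots,x_n)]'+\sum_{0\le i<j\le n}(-1)^{i+j}\varphi([x_i,x_j],\alpha(x_0),\dots,\widehat{x_i},\dots,\widehat{x_j},\dots,\alpha(x_n)).$$ $C^n_{HL}(\mathcal{L},\mathcal{L})$ and $C^n_{HL}(\mathcal{L}',\mathcal{L}')$, with their operators $\delta^n_{HL}$, are the case $\phi=\mathrm{id}$ of this. For $\lambda\in C^n_{HL}(\mathcal{L}',\mathcal{L}')$, $(\lambda\diamond\phi)(x_1,\dots,x_n)=\lambda(\phi(x_1),\dots,\phi(x_n))$. The module of $n$-cochains of $\phi$ is $C^n_{HL}(\phi,\phi)=C^n_{HL}(\mathcal{L},\mathcal{L})\times C^n_{HL}(\mathcal{L}',\mathcal{L}')\times\widetilde{C}^{n-1}_{\alpha,\alpha'}(\mathcal{L},\mathcal{L}')$. Convention: $\delta^0_{HL}=0$ (so the third component plays no role in $\delta^1$). *)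

theory Defs
  imports "HOL-Computational_Algebra.Computational_Algebra"
    "HOL-Library.Function_Algebras" "HOL-Library.Product_Plus"
begin

record ('k, 'a) hom_lie =
  hl_scale :: "'k \<Rightarrow> 'a \<Rightarrow> 'a"
  hl_bracket :: "'a \<Rightarrow> 'a \<Rightarrow> 'a"
  hl_twist :: "'a \<Rightarrow> 'a"

locale hom_lie_algebra = vector_space "hl_scale L"
  for L :: "('k::field, 'a::ab_group_add) hom_lie" +
  assumes bracket_linear_left:
      "\<And>y. Vector_Spaces.linear (hl_scale L) (hl_scale L) (\<lambda>x. hl_bracket L x y)"
    and bracket_linear_right:
      "\<And>x. Vector_Spaces.linear (hl_scale L) (hl_scale L) (\<lambda>y. hl_bracket L x y)"
    and bracket_skew: "\<And>x y. hl_bracket L x y = - hl_bracket L y x"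
    and twist_linear: "Vector_Spaces.linear (hl_scale L) (hl_scale L) (hl_twist L)"
    and hom_jacobi: "\<And>x y z.
      hl_bracket L (hl_twist L x) (hl_bracket L y z) +
      hl_bracket L (hl_twist L y) (hl_bracket L z x) +
      hl_bracket L (hl_twist L z) (hl_bracket L x y) = 0"

locale multiplicative_hom_lie_algebra = hom_lie_algebra +
  assumes twist_bracket:
    "\<And>x y. hl_twist L (hl_bracket L x y) = hl_bracket L (hl_twist L x) (hl_twist L y)"

definition hom_lie_morphism ::
  "('k::field, 'a::ab_group_add) hom_lie \<Rightarrow> ('k, 'b::ab_group_add) hom_lie \<Rightarrow> ('a \<Rightarrow> 'b) \<Rightarrow> bool"
  where "hom_lie_morphism L L' \<phi> \<longleftrightarrow>
    Vector_Spaces.linear (hl_scale L) (hl_scale L') \<phi> \<and>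
    (\<forall>x y. hl_bracket L' (\<phi> x) (\<phi> y) = \<phi> (hl_bracket L x y)) \<and>
    \<phi> \<circ> hl_twist L = hl_twist L' \<circ> \<phi>"

text \<open>
  A map of \<open>n\<close> arguments is a function on lists that is only relevant on lists of length \<open>n\<close>;
  it is required to vanish on all other lists, so that equality of such maps is equality of
  functions.
\<close>

definition multilinear ::
  "('k::field \<Rightarrow> 'a::ab_group_add \<Rightarrow> 'a) \<Rightarrow> ('k \<Rightarrow> 'b::ab_group_add \<Rightarrow> 'b) \<Rightarrow> nat \<Rightarrow>
    ('a list \<Rightarrow> 'b) \<Rightarrow> bool"
  where "multilinear s s' n f \<longleftrightarrow>
    (\<forall>xs i. length xs = n \<longrightarrow> i < n \<longrightarrow> Vector_Spaces.linear s s' (\<lambda>x. f (xs[i := x])))"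

definition skew_symmetric :: "nat \<Rightarrow> ('a list \<Rightarrow> 'b::ab_group_add) \<Rightarrow> bool"
  where "skew_symmetric n f \<longleftrightarrow>
    (\<forall>xs i j. length xs = n \<longrightarrow> i < j \<longrightarrow> j < n \<longrightarrow> f (xs[i := xs ! j, j := xs ! i]) = - f xs)"

text \<open>
  In degree \<open>0\<close> the space is all of \<open>L'\<close>, an element \<open>v\<close> being encoded as the function with value
  \<open>v\<close> at \<open>[]\<close>; compatibility with the twists is only required in positive degree.
\<close>

definition hl_cochains ::
  "('k::field, 'a::ab_group_add) hom_lie \<Rightarrow> ('k, 'b::ab_group_add) hom_lie \<Rightarrow> nat \<Rightarrow>
    ('a list \<Rightarrow> 'b) set"
  where "hl_cochains L L' n = {f.
    (\<forall>xs. length xs \<noteq> n \<longrightarrow> f xs = 0) \<and>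
    (n \<ge> 1 \<longrightarrow> multilinear (hl_scale L) (hl_scale L') n f \<and> skew_symmetric n f \<and>
      (\<forall>xs. length xs = n \<longrightarrow> hl_twist L' (f xs) = f (map (hl_twist L) xs)))}"

text \<open>
  The operator is \<open>0\<close> in degree \<open>0\<close>. The list \<open>nths xs (- A)\<close> is \<open>xs\<close> with the entries at the
  positions in \<open>A\<close> omitted.
\<close>

definition hl_coboundary ::
  "('k::field, 'a::ab_group_add) hom_lie \<Rightarrow> ('k, 'b::ab_group_add) hom_lie \<Rightarrow> ('a \<Rightarrow> 'b) \<Rightarrow> nat \<Rightarrow>
    ('a list \<Rightarrow> 'b) \<Rightarrow> ('a list \<Rightarrow> 'b)"
  where "hl_coboundary L L' \<phi> n f = (\<lambda>xs.
    if n = 0 \<or> length xs \<noteq> Suc n then 0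
    else
      (\<Sum>i\<in>{0..n}. hl_scale L' ((-1) ^ i)
        (hl_bracket L' (\<phi> ((hl_twist L ^^ (n - 1)) (xs ! i))) (f (nths xs (- {i}))))) +
      (\<Sum>(i, j)\<in>{(i, j). i < j \<and> j \<le> n}. hl_scale L' ((-1) ^ (i + j))
        (f (hl_bracket L (xs ! i) (xs ! j) # map (hl_twist L) (nths xs (- {i, j}))))))"

type_synonym ('a, 'b) morphism_cochain =
  "('a list \<Rightarrow> 'a) \<times> ('b list \<Rightarrow> 'b) \<times> ('a list \<Rightarrow> 'b)"

definition morphism_cochains ::
  "('k::field, 'a::ab_group_add) hom_lie \<Rightarrow> ('k, 'b::ab_group_add) hom_lie \<Rightarrow> nat \<Rightarrow>
    ('a, 'b) morphism_cochain set"
  where "morphism_cochains L L' n =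
    hl_cochains L L n \<times> hl_cochains L' L' n \<times> hl_cochains L L' (n - 1)"

definition morphism_cochain_scale ::
  "('k::field, 'a::ab_group_add) hom_lie \<Rightarrow> ('k, 'b::ab_group_add) hom_lie \<Rightarrow> 'k \<Rightarrow>
    ('a, 'b) morphism_cochain \<Rightarrow> ('a, 'b) morphism_cochain"
  where "morphism_cochain_scale L L' a = (\<lambda>(f1, f2, f3).
    (\<lambda>xs. hl_scale L a (f1 xs), \<lambda>xs. hl_scale L' a (f2 xs), \<lambda>xs. hl_scale L' a (f3 xs)))"

definition diamond :: "('b list \<Rightarrow> 'c) \<Rightarrow> ('a \<Rightarrow> 'b) \<Rightarrow> ('a list \<Rightarrow> 'c)"
  where "diamond g \<phi> = (\<lambda>xs. g (map \<phi> xs))"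

definition morphism_coboundary ::
  "('k::field, 'a::ab_group_add) hom_lie \<Rightarrow> ('k, 'b::ab_group_add) hom_lie \<Rightarrow> ('a \<Rightarrow> 'b) \<Rightarrow> nat \<Rightarrow>
    ('a, 'b) morphism_cochain \<Rightarrow> ('a, 'b) morphism_cochain"
  where "morphism_coboundary L L' \<phi> n = (\<lambda>(f1, f2, f3).
    (hl_coboundary L L id n f1,
     hl_coboundary L' L' id n f2,
     \<lambda>xs. hl_coboundary L L' \<phi> (n - 1) f3 xs +
       hl_scale L' ((-1) ^ (n - 1)) ((\<phi> \<circ> f1) xs - diamond f2 \<phi> xs)))"

text \<open>
  Complexes are indexed by the degrees \<open>n \<ge> 1\<close>; the space in degree \<open>n\<close> is a subspace \<open>C n\<close>
  of an ambient vector space with scalar multiplication \<open>s\<close>, and \<open>d n\<close> matters only on \<open>C n\<close>.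
\<close>

definition cochain_complex ::
  "('k::field \<Rightarrow> 'c::ab_group_add \<Rightarrow> 'c) \<Rightarrow> (nat \<Rightarrow> 'c set) \<Rightarrow> (nat \<Rightarrow> 'c \<Rightarrow> 'c) \<Rightarrow> bool"
  where "cochain_complex s C d \<longleftrightarrow>
    vector_space s \<and>
    (\<forall>n\<ge>1. module.subspace s (C n) \<and>
      (\<forall>x\<in>C n. d n x \<in> C (n + 1)) \<and>
      (\<forall>x\<in>C n. \<forall>y\<in>C n. d n (x + y) = d n x + d n y) \<and>
      (\<forall>a. \<forall>x\<in>C n. d n (s a x) = s a (d n x)) \<and>
      (\<forall>x\<in>C n. d (n + 1) (d n x) = 0))"

end

theory Submission
  imports Defs
begin

text \<open>
  On lists the coboundary can be described recursively, without reference to degrees: writing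
  \<open>\<iota>\<^sub>x f = f (x # _)\<close>, the value of the coboundary at \<open>x # xs\<close> is \<open>[\<phi> (\<alpha>\<^sup>m x), f xs]\<close> minus the action
  of \<open>x\<close> on the arguments of \<open>f\<close> minus the coboundary of the contraction \<open>\<iota>\<^sub>x f\<close> (Cartan's magic
  formula). In this form, where \<open>[x\<^sub>i, x\<^sub>j]\<close> stands in position \<open>j\<close> as in the Loday complex of a
  Leibniz algebra, the square of the coboundary vanishes by induction on the list, once the
  coboundary is known to commute with Lie derivatives; skew-symmetry is only needed to identify it
  with the given formula. Since it commutes with \<open>\<phi> \<circ> _\<close> and \<open>_ \<diamondop> \<phi>\<close>, the cochains of the morphism
  form the mapping cone of \<open>\<phi> \<circ> f\<^sub>1 - f\<^sub>2 \<diamondop> \<phi>\<close>.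
\<close>

section \<open>The recursive coboundary\<close>

text \<open>
  \<open>lie_act L f x [y\<^sub>1, \<dots>, y\<^sub>n]\<close> is \<open>\<Sum>\<^sub>j f [\<alpha> y\<^sub>1, \<dots>, [x, y\<^sub>j], \<dots>, \<alpha> y\<^sub>n]\<close>.
\<close>

fun lie_act :: "('k, 'a) hom_lie \<Rightarrow> ('a list \<Rightarrow> 'b::ab_group_add) \<Rightarrow> 'a \<Rightarrow> 'a list \<Rightarrow> 'b" where
  "lie_act L f x [] = 0"
| "lie_act L f x (y # ys) =
    f (hl_bracket L x y # map (hl_twist L) ys) + lie_act L (\<lambda>zs. f (hl_twist L y # zs)) x ys"

text \<open>
  Contraction with \<open>x\<close> does not preserve compatibility with the twists: \<open>\<alpha>' \<circ> \<iota>\<^sub>x f\<close> is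
  \<open>\<iota>\<^bsub>\<alpha> x\<^esub> f \<circ> \<alpha>\<close>. Therefore the two sums of the coboundary are applied to separate functions
  \<open>g\<close> and \<open>h\<close>, related by \<open>\<alpha>' \<circ> g = h \<circ> \<alpha>\<close>; the coboundary of \<open>f\<close> is the case \<open>g = h = f\<close>.
\<close>

fun loday_coboundary :: "('k, 'a) hom_lie \<Rightarrow> ('a \<Rightarrow> 'b \<Rightarrow> 'b::ab_group_add) \<Rightarrow>
    ('a list \<Rightarrow> 'b) \<Rightarrow> ('a list \<Rightarrow> 'b) \<Rightarrow> 'a list \<Rightarrow> 'b" where
  "loday_coboundary L A g h [] = 0"
| "loday_coboundary L A g h (x # xs) =
    A x (g xs) - lie_act L h x xs -
    loday_coboundary L A (\<lambda>zs. g (x # zs)) (\<lambda>zs. h (hl_twist L x # zs)) xs"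

section \<open>Naturality of the recursive operators in coefficients and arguments, and their
  support\<close>

lemma lie_act_add: "lie_act L (\<lambda>zs. f zs + g zs) x ys = lie_act L f x ys + lie_act L g x ys"
  by (induction ys arbitrary: f g) (simp_all add: algebra_simps)

text \<open>Only sums occur in \<open>lie_act\<close>, so any additive \<open>F\<close> passes
  through. This covers negation, the operators of an action, the twist, \<open>\<phi>\<close> and
  scalar multiplication.\<close>

lemma lie_act_comp:
  assumes "additive F"
  shows "F (lie_act L f x ys) = lie_act L (\<lambda>zs. F (f zs)) x ys"
  by (induction ys arbitrary: f) (simp_all add: additive.zero[OF assms] additive.add[OF assms])

lemma additive_uminus: "additive (uminus :: 'a::ab_group_add \<Rightarrow> 'a)"
  by unfold_locales simp

lemma lie_act_uminus: "lie_act L (\<lambda>zs. - f zs) x ys = - lie_act L f x ys"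
  by (rule lie_act_comp[where F = uminus, OF additive_uminus, symmetric])

lemma lie_act_diff: "lie_act L (\<lambda>zs. f zs - g zs) x ys = lie_act L f x ys - lie_act L g x ys"
  using lie_act_add[of L f "\<lambda>zs. - g zs"] by (simp add: lie_act_uminus)

lemma lie_act_map:
  assumes "\<And>x y. hl_bracket L' (\<psi> x) (\<psi> y) = \<psi> (hl_bracket L x y)"
    and "\<And>x. hl_twist L' (\<psi> x) = \<psi> (hl_twist L x)"
  shows "lie_act L' f (\<psi> x) (map \<psi> ys) = lie_act L (\<lambda>zs. f (map \<psi> zs)) x ys"
  by (induction ys arbitrary: f) (simp_all add: assms comp_def)

text \<open>Each contraction lowers by one the length on which the function can be nonzero, while
  the bracket term keeps the length.\<close>

lemma lie_act_eq_0:
  assumes "\<And>zs. length zs \<noteq> n \<Longrightarrow> f zs = 0" and "length ys \<noteq> n"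
  shows "lie_act L f x ys = 0"
  using assms
proof (induction ys arbitrary: f n)
  case (Cons y ys)
  have "lie_act L (\<lambda>zs. f (hl_twist L y # zs)) x ys = 0"
  proof (cases n)
    case (Suc m)
    then show ?thesis using Cons by (intro Cons.IH[of m]) auto
  next
    case 0
    then have "\<And>zs. f (hl_twist L y # zs) = 0" using Cons.prems(1) by simp
    \<comment> \<open>The contraction is zero on all lists, so the induction hypothesis may be used
      with any number other than the length of \<open>ys\<close>.\<close>
    then show ?thesis using Cons.IH[of "Suc (length ys)" "\<lambda>zs. f (hl_twist L y # zs)"] by simp
  qed
  then show ?case using Cons.prems by simp
qed simp

lemma loday_add:
  assumes "\<And>x. additive (A x)"
  shows "loday_coboundary L A (\<lambda>zs. g zs + g' zs) (\<lambda>zs. h zs + h' zs) xs =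
    loday_coboundary L A g h xs + loday_coboundary L A g' h' xs"
  by (induction xs arbitrary: g g' h h')
    (simp_all add: additive.add[OF assms] lie_act_add algebra_simps)

text \<open>Naturality in the coefficients: \<open>F\<close> intertwines the actions
  \<open>A\<close> and \<open>A'\<close>.\<close>

lemma loday_comp:
  assumes "additive F" and "\<And>x v. F (A x v) = A' x (F v)"
  shows "F (loday_coboundary L A g h xs) = loday_coboundary L A' (\<lambda>zs. F (g zs)) (\<lambda>zs. F (h zs)) xs"
  by (induction xs arbitrary: g h)
    (simp_all add: additive.zero[OF assms(1)] additive.diff[OF assms(1)] assms(2)
      lie_act_comp[OF assms(1)])

lemma loday_uminus:
  assumes "\<And>x. additive (A x)"
  shows "loday_coboundary L A (\<lambda>zs. - g zs) (\<lambda>zs. - h zs) xs = - loday_coboundary L A g h xs"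
  by (rule loday_comp[where F = uminus, OF additive_uminus, symmetric]) (simp add: additive.minus[OF assms])

lemma loday_diff:
  assumes "\<And>x. additive (A x)"
  shows "loday_coboundary L A (\<lambda>zs. g zs - g' zs) (\<lambda>zs. h zs - h' zs) xs =
    loday_coboundary L A g h xs - loday_coboundary L A g' h' xs"
  using loday_add[OF assms, where L = L and g = g and g' = "\<lambda>zs. - g' zs" and h = h
      and h' = "\<lambda>zs. - h' zs" and xs = xs]
  unfolding loday_uminus[OF assms] by simp

text \<open>Naturality in the arguments: the action is pulled back along \<open>\<psi>\<close>. It
  is applied to the twist and to the morphism \<open>\<phi>\<close>.\<close>

lemma loday_map:
  assumes "\<And>x y. hl_bracket L' (\<psi> x) (\<psi> y) = \<psi> (hl_bracket L x y)"
    and "\<And>x. hl_twist L' (\<psi> x) = \<psi> (hl_twist L x)"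
  shows "loday_coboundary L' A g h (map \<psi> xs) =
    loday_coboundary L (\<lambda>x. A (\<psi> x)) (\<lambda>zs. g (map \<psi> zs)) (\<lambda>zs. h (map \<psi> zs)) xs"
  by (induction xs arbitrary: g h) (simp_all add: assms lie_act_map[OF assms])

lemma loday_eq_0:
  assumes "\<And>x. additive (A x)"
    and "\<And>zs. length zs \<noteq> n \<Longrightarrow> g zs = 0" and "\<And>zs. length zs \<noteq> n \<Longrightarrow> h zs = 0"
    and "length xs \<noteq> Suc n"
  shows "loday_coboundary L A g h xs = 0"
  using assms(2-)
proof (induction xs arbitrary: g h n)
  case (Cons x xs)
  have "loday_coboundary L A (\<lambda>zs. g (x # zs)) (\<lambda>zs. h (hl_twist L x # zs)) xs = 0"
  proof (cases n)
    case (Suc m)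
    then show ?thesis using Cons.prems by (intro Cons.IH[of m]) auto
  next
    case 0
    then show ?thesis using Cons.prems by (intro Cons.IH[of "length xs"]) auto
  qed
  moreover have "lie_act L h x xs = 0"
    using Cons.prems by (intro lie_act_eq_0[of n]) auto
  ultimately show ?case using Cons.prems by (simp add: additive.zero[OF assms(1)])
qed simp

section \<open>Multilinearity and skew-symmetry\<close>

lemma linear_comp:
  "Vector_Spaces.linear s s' f \<Longrightarrow> Vector_Spaces.linear s' s'' g \<Longrightarrow>
    Vector_Spaces.linear s s'' (\<lambda>x. g (f x))"
  by (simp add: Vector_Spaces.linear_iff)

lemma linear_plus:
  "Vector_Spaces.linear s s' f \<Longrightarrow> Vector_Spaces.linear s s' g \<Longrightarrow>
    Vector_Spaces.linear s s' (\<lambda>x. f x + g x)"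
  by (auto simp: Vector_Spaces.linear_iff algebra_simps vector_space.vector_space_assms(1))

lemma linear_minus:
  assumes "Vector_Spaces.linear s s' f" and "Vector_Spaces.linear s s' g"
  shows "Vector_Spaces.linear s s' (\<lambda>x. f x - g x)"
proof -
  interpret V: vector_space s' using assms by (simp add: Vector_Spaces.linear_iff)
  show ?thesis using assms by (auto simp: Vector_Spaces.linear_iff V.scale_right_diff_distrib)
qed

lemma linear_0:
  assumes "vector_space s" and "vector_space s'"
  shows "Vector_Spaces.linear s s' (\<lambda>x. 0)"
proof -
  interpret V: vector_space s' by fact
  show ?thesis using assms by (simp add: Vector_Spaces.linear_iff)
qed

lemma additive_if_linear: "Vector_Spaces.linear s s' f \<Longrightarrow> additive f"
  by (simp add: Vector_Spaces.linear_iff additive_def)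

text \<open>
  Cochains vanish off one length, so their multilinearity and skew-symmetry can be stated for
  lists of all lengths.
\<close>

definition slot_linear :: "('k::field \<Rightarrow> 'a::ab_group_add \<Rightarrow> 'a) \<Rightarrow> ('k \<Rightarrow> 'b::ab_group_add \<Rightarrow> 'b) \<Rightarrow>
    ('a list \<Rightarrow> 'b) \<Rightarrow> bool" where
  "slot_linear s s' f \<longleftrightarrow> (\<forall>as bs. Vector_Spaces.linear s s' (\<lambda>x. f (as @ x # bs)))"

definition slot_skew :: "('a list \<Rightarrow> 'b::ab_group_add) \<Rightarrow> bool" where
  "slot_skew f \<longleftrightarrow> (\<forall>as x y bs. f (as @ x # y # bs) = - f (as @ y # x # bs))"

lemma slot_linear_Cons: "slot_linear s s' f \<Longrightarrow> slot_linear s s' (\<lambda>zs. f (x # zs))"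
  unfolding slot_linear_def
proof (intro allI)
  fix as bs
  assume "\<forall>as bs. Vector_Spaces.linear s s' (\<lambda>x. f (as @ x # bs))"
  from this[rule_format, of "x # as" bs]
  show "Vector_Spaces.linear s s' (\<lambda>y. f (x # as @ y # bs))" by simp
qed

lemma slot_linear_hd: "slot_linear s s' f \<Longrightarrow> Vector_Spaces.linear s s' (\<lambda>x. f (x # bs))"
  unfolding slot_linear_def by (drule spec[of _ "[]"]) simp

lemma slot_skew_Cons: "slot_skew f \<Longrightarrow> slot_skew (\<lambda>zs. f (x # zs))"
  unfolding slot_skew_def
proof (intro allI)
  fix as y z bs
  assume "\<forall>as x y bs. f (as @ x # y # bs) = - f (as @ y # x # bs)"
  from this[rule_format, of "x # as" y z bs]
  show "f (x # as @ y # z # bs) = - f (x # as @ z # y # bs)" by simp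
qed

lemma slot_skewD: "slot_skew f \<Longrightarrow> f (as @ x # y # bs) = - f (as @ y # x # bs)"
  unfolding slot_skew_def by blast

lemma slot_skew_hd: "slot_skew f \<Longrightarrow> f (x # y # bs) = - f (y # x # bs)"
  using slot_skewD[of f "[]" x y bs] unfolding append_Nil .

text \<open>Adjacent exchanges suffice: \<open>x\<close> moves behind \<open>m\<close>, the
  induction hypothesis exchanges \<open>x\<close> and \<open>y\<close> across \<open>ms\<close>, and
  \<open>y\<close> moves in front of \<open>m\<close>. The three sign changes leave one
  minus.\<close>

lemma slot_skew_transpose:
  assumes "slot_skew f"
  shows "f (as @ x # ms @ y # bs) = - f (as @ y # ms @ x # bs)"
proof (induction ms arbitrary: as)
  case Nil
  then show ?case unfolding append_Nil by (rule slot_skewD[OF assms])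
next
  case (Cons m ms)
  have "f (as @ x # (m # ms) @ y # bs) = - f (as @ m # x # ms @ y # bs)"
    unfolding append_Cons by (rule slot_skewD[OF assms])
  also have "f (as @ m # x # ms @ y # bs) = - f (as @ m # y # ms @ x # bs)"
    using Cons.IH[of "as @ [m]"] by simp
  also have "f (as @ m # y # ms @ x # bs) = - f (as @ y # (m # ms) @ x # bs)"
    unfolding append_Cons by (rule slot_skewD[OF assms])
  finally show ?case by simp
qed

lemma two_slots_decomp:
  assumes "i < j" and "j < length xs"
  obtains as x ms y bs where "xs = as @ x # ms @ y # bs" and "length as = i"
    and "xs[i := xs ! j, j := xs ! i] = as @ y # ms @ x # bs"
proof -
  define as where "as = take i xs"
  define ms where "ms = take (j - Suc i) (drop (Suc i) xs)"
  define bs where "bs = drop (Suc j) xs"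
  have 1: "xs = as @ xs ! i # drop (Suc i) xs"
    unfolding as_def using assms by (simp add: id_take_nth_drop)
  have "drop (Suc i) xs = ms @ drop (Suc i) xs ! (j - Suc i) # drop (Suc (j - Suc i)) (drop (Suc i) xs)"
    unfolding ms_def using assms by (intro id_take_nth_drop) simp
  then have 2: "drop (Suc i) xs = ms @ xs ! j # bs"
    using assms by (simp add: bs_def)
  have xs: "xs = as @ xs ! i # ms @ xs ! j # bs"
    using 1 2 by simp
  have la: "length as = i" and lm: "length ms = j - Suc i"
    using assms by (auto simp: as_def ms_def)
  have j: "j = length as + Suc (length ms)" using la lm assms by simp
  have "(as @ x # ms @ y # bs)[i := y, j := x] = as @ y # ms @ x # bs" for x y
    unfolding j la[symmetric] by (simp add: list_update_append)
  then show ?thesis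
    using that[OF xs la] xs by metis
qed

lemma skew_symmetric_if_slot_skew: "slot_skew f \<Longrightarrow> skew_symmetric n f"
  unfolding skew_symmetric_def
proof (intro allI impI)
  fix xs :: "'a list" and i j
  assume f: "slot_skew f" and "length xs = n" "i < j" "j < n"
  then obtain as x ms y bs where xs: "xs = as @ x # ms @ y # bs"
    and upd: "xs[i := xs ! j, j := xs ! i] = as @ y # ms @ x # bs"
    by (metis two_slots_decomp)
  show "f (xs[i := xs ! j, j := xs ! i]) = - f xs"
    unfolding upd unfolding xs by (rule slot_skew_transpose[OF f])
qed

lemma slot_skew_if_skew_symmetric:
  assumes "skew_symmetric n f" and "\<And>zs. length zs \<noteq> n \<Longrightarrow> f zs = 0"
  shows "slot_skew f"
  unfolding slot_skew_def
proof (intro allI)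
  fix as bs and x y
  show "f (as @ x # y # bs) = - f (as @ y # x # bs)"
  proof (cases "length (as @ x # y # bs) = n")
    case True
    let ?xs = "as @ y # x # bs" and ?i = "length as"
    have "f (?xs[?i := ?xs ! Suc ?i, Suc ?i := ?xs ! ?i]) = - f ?xs"
    proof -
      have "length ?xs = n" "?i < Suc ?i" "Suc ?i < n" using True by auto
      then show ?thesis using assms(1) unfolding skew_symmetric_def by blast
    qed
    moreover have "?xs[?i := ?xs ! Suc ?i, Suc ?i := ?xs ! ?i] = as @ x # y # bs"
      by (induction as) auto
    ultimately show ?thesis by simp
  next
    case False
    then show ?thesis using assms(2) by simp
  qed
qed

lemma multilinear_iff_slot_linear:
  assumes "vector_space s" and "vector_space s'" and "\<And>zs. length zs \<noteq> n \<Longrightarrow> f zs = 0"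
  shows "multilinear s s' n f \<longleftrightarrow> slot_linear s s' f"
proof
  assume m: "multilinear s s' n f"
  show "slot_linear s s' f"
    unfolding slot_linear_def
  proof (intro allI)
    fix as bs
    show "Vector_Spaces.linear s s' (\<lambda>x. f (as @ x # bs))"
    proof (cases "length as + Suc (length bs) = n")
      case True
      \<comment> \<open>The entry \<open>0\<close> is only a placeholder for the position that is
        updated.\<close>
      then have "Vector_Spaces.linear s s' (\<lambda>x. f ((as @ 0 # bs)[length as := x]))"
        using m[unfolded multilinear_def, rule_format, of "as @ 0 # bs" "length as"] by simp
      then show ?thesis by simp
    next
      case False
      then have "f (as @ x # bs) = 0" for x using assms(3) by simp
      then show ?thesis using linear_0[OF assms(1,2)] by simp
    qed
  qed
next
  assume "slot_linear s s' f"
  then show "multilinear s s' n f"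
    unfolding multilinear_def slot_linear_def by (auto simp: upd_conv_take_nth_drop)
qed

section \<open>Linearity and skew-symmetry of the recursive operators in the list of
  arguments\<close>

lemma linear_lie_act_param:
  assumes "vector_space s" and "vector_space s'"
    and "\<And>zs. Vector_Spaces.linear s s' (\<lambda>y. f y zs)"
  shows "Vector_Spaces.linear s s' (\<lambda>y. lie_act L (f y) x zs)"
  using assms(3)
  by (induction zs arbitrary: f) (simp_all add: linear_0[OF assms(1,2)] linear_plus)

lemma linear_loday_param:
  assumes "vector_space s" and "vector_space s'"
    and A: "\<And>x. Vector_Spaces.linear s' s' (A x)"
    and "\<And>zs. Vector_Spaces.linear s s' (\<lambda>y. g y zs)"
    and "\<And>zs. Vector_Spaces.linear s s' (\<lambda>y. h y zs)"
  shows "Vector_Spaces.linear s s' (\<lambda>y. loday_coboundary L A (g y) (h y) zs)"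
  using assms(4,5)
proof (induction zs arbitrary: g h)
  case (Cons z zs)
  then show ?case
    unfolding loday_coboundary.simps
    by (intro linear_minus linear_comp[OF _ A] linear_lie_act_param Cons.IH assms(1,2))
qed (simp add: linear_0[OF assms(1,2)])

lemma (in hom_lie_algebra) linear_lie_act_left:
  assumes "slot_linear (hl_scale L) s' f" and "vector_space s'"
  shows "Vector_Spaces.linear (hl_scale L) s' (\<lambda>x. lie_act L f x zs)"
  using assms(1)
proof (induction zs arbitrary: f)
  case (Cons z zs)
  show ?case
    unfolding lie_act.simps
    by (intro linear_plus Cons.IH slot_linear_Cons Cons.prems
        linear_comp[OF bracket_linear_left slot_linear_hd])
qed (simp add: linear_0[OF vector_space_axioms assms(2)])

lemma (in hom_lie_algebra) linear_map_twist_slot: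
  assumes "slot_linear (hl_scale L) s' f"
  shows "Vector_Spaces.linear (hl_scale L) s' (\<lambda>y. f (x # map (hl_twist L) (as @ y # bs)))"
  using slot_linear_Cons[OF assms, of x, unfolded slot_linear_def, rule_format,
      of "map (hl_twist L) as" "map (hl_twist L) bs"]
  by (auto dest: linear_comp[OF twist_linear])

text \<open>Induction on the entries before the slot. When the slot is the head, its entry
  \<open>y\<close> occurs both in the bracket and, twisted, as the contracted argument of
  \<open>f\<close>; the latter occurrence needs linearity in a parameter of the function,
  \<open>linear_lie_act_param\<close>.\<close>

lemma (in hom_lie_algebra) slot_linear_lie_act:
  assumes "slot_linear (hl_scale L) s' f"
  shows "slot_linear (hl_scale L) s' (lie_act L f x)"
  unfolding slot_linear_def
proof (intro allI)
  fix as bs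
  have vs': "vector_space s'"
    using slot_linear_hd[OF assms, of "[]"] by (simp add: Vector_Spaces.linear_iff)
  show "Vector_Spaces.linear (hl_scale L) s' (\<lambda>y. lie_act L f x (as @ y # bs))"
    using assms
  proof (induction as arbitrary: f)
    case Nil
    have "Vector_Spaces.linear (hl_scale L) s' (\<lambda>y. f (hl_twist L y # zs))" for zs
      by (rule linear_comp[OF twist_linear slot_linear_hd[OF Nil]])
    then show ?case
      unfolding append_Nil lie_act.simps
      by (intro linear_plus linear_comp[OF bracket_linear_right slot_linear_hd[OF Nil]]
          linear_lie_act_param vector_space_axioms vs')
  next
    case (Cons a as)
    show ?case
      unfolding append_Cons lie_act.simps
      by (intro linear_plus Cons.IH slot_linear_Cons Cons.prems linear_map_twist_slot)
  qed
qed

lemma (in hom_lie_algebra) slot_linear_loday: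
  assumes "slot_linear (hl_scale L) s' g" and "slot_linear (hl_scale L) s' h"
    and A: "\<And>x. Vector_Spaces.linear s' s' (A x)"
    and A_left: "\<And>v. Vector_Spaces.linear (hl_scale L) s' (\<lambda>x. A x v)"
  shows "slot_linear (hl_scale L) s' (loday_coboundary L A g h)"
  unfolding slot_linear_def
proof (intro allI)
  fix as bs
  have vs': "vector_space s'"
    using slot_linear_hd[OF assms(1), of "[]"] by (simp add: Vector_Spaces.linear_iff)
  show "Vector_Spaces.linear (hl_scale L) s' (\<lambda>y. loday_coboundary L A g h (as @ y # bs))"
    using assms(1,2)
  proof (induction as arbitrary: g h)
    case Nil
    have "Vector_Spaces.linear (hl_scale L) s' (\<lambda>y. h (hl_twist L y # zs))" for zs
      by (rule linear_comp[OF twist_linear slot_linear_hd[OF Nil(2)]])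
    then show ?case
      unfolding append_Nil loday_coboundary.simps
      by (intro linear_minus A_left linear_loday_param A linear_lie_act_left
          slot_linear_hd[OF Nil(1)] Nil vector_space_axioms vs')
  next
    case (Cons a as)
    have "Vector_Spaces.linear (hl_scale L) s' (\<lambda>y. g (as @ y # bs))"
      "Vector_Spaces.linear (hl_scale L) s' (\<lambda>y. lie_act L h a (as @ y # bs))"
      using Cons.prems(1) slot_linear_lie_act[OF Cons.prems(2)] by (simp_all add: slot_linear_def)
    then show ?case
      unfolding append_Cons loday_coboundary.simps
      by (intro linear_minus linear_comp[OF _ A] Cons.IH slot_linear_Cons Cons.prems)
  qed
qed

text \<open>With \<open>x\<close> and \<open>y\<close> in front, exchanging them exchanges the term
  with \<open>[a, x]\<close> and the term with \<open>[a, y]\<close> up to sign, and contractions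
  with the two twisted entries anticommute. Exchanges further back are handled by induction.\<close>

lemma slot_skew_lie_act:
  assumes "slot_skew f"
  shows "slot_skew (lie_act L f a)"
  unfolding slot_skew_def
proof (intro allI)
  fix as x y bs
  show "lie_act L f a (as @ x # y # bs) = - lie_act L f a (as @ y # x # bs)"
    using assms
  proof (induction as arbitrary: f)
    case Nil
    have "(\<lambda>zs. f (hl_twist L x # hl_twist L y # zs)) = (\<lambda>zs. - f (hl_twist L y # hl_twist L x # zs))"
      using slot_skew_hd[OF Nil] by blast
    then show ?case
      using slot_skew_hd[OF Nil, of "hl_bracket L a x"] slot_skew_hd[OF Nil, of "hl_twist L x"]
      by (simp add: lie_act_uminus)
  next
    case (Cons b as)
    show ?case
      using Cons.IH[OF slot_skew_Cons[OF Cons.prems]]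
        slot_skewD[OF Cons.prems, of "hl_bracket L a b # map (hl_twist L) as" "hl_twist L x"]
      by simp
  qed
qed

text \<open>Unfolding twice at \<open>x # y # bs\<close> gives action terms and
  \<open>lie_act\<close> terms that are antisymmetric in \<open>x\<close> and \<open>y\<close>, a
  twofold contraction, and the term of \<open>h\<close> at \<open>[x, y]\<close>. The last one
  changes sign because the bracket is skew and \<open>h\<close> is linear in its first slot.\<close>

lemma (in hom_lie_algebra) slot_skew_loday:
  assumes "slot_skew g" and "slot_skew h"
    and "slot_linear (hl_scale L) s' h"
    and A: "\<And>x. additive (A x)"
  shows "slot_skew (loday_coboundary L A g h)"
  unfolding slot_skew_def
proof (intro allI)
  fix as x y bs
  show "loday_coboundary L A g h (as @ x # y # bs) = - loday_coboundary L A g h (as @ y # x # bs)"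
    using assms(1-3)
  proof (induction as arbitrary: g h)
    case Nil
    have g: "(\<lambda>zs. g (x # y # zs)) = (\<lambda>zs. - g (y # x # zs))"
      using slot_skew_hd[OF Nil(1)] by blast
    have h: "(\<lambda>zs. h (hl_twist L x # hl_twist L y # zs)) = (\<lambda>zs. - h (hl_twist L y # hl_twist L x # zs))"
      using slot_skew_hd[OF Nil(2)] by blast
    have "additive (\<lambda>z. h (z # zs))" for zs
      using additive_if_linear[OF slot_linear_hd[OF Nil(3)]] .
    then have "h (hl_bracket L x y # zs) = - h (hl_bracket L y x # zs)" for zs
      using bracket_skew[of x y] additive.minus by fastforce
    then show ?case
      by (simp add: g h loday_uminus[OF A])
  next
    case (Cons b as)
    then have "loday_coboundary L A (\<lambda>zs. g (b # zs)) (\<lambda>zs. h (hl_twist L b # zs)) (as @ x # y # bs) =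
      - loday_coboundary L A (\<lambda>zs. g (b # zs)) (\<lambda>zs. h (hl_twist L b # zs)) (as @ y # x # bs)"
      by (intro Cons.IH slot_skew_Cons slot_linear_Cons)
    then show ?case
      using slot_skewD[OF Cons.prems(1), of as x y bs]
        slot_skewD[OF slot_skew_lie_act[OF Cons.prems(2)], of L b as x y bs]
      by (simp add: additive.minus[OF A])
  qed
qed

section \<open>The square of the coboundary\<close>

text \<open>The left Hom-Leibniz rule: bracketing with \<open>x\<close> is a derivation up to
  twists. Skew-symmetry brings the Hom-Jacobi identity into this form.\<close>

lemma (in hom_lie_algebra) hom_jacobi_left:
  "hl_bracket L (hl_twist L x) (hl_bracket L y z) =
    hl_bracket L (hl_bracket L x y) (hl_twist L z) + hl_bracket L (hl_twist L y) (hl_bracket L x z)"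
proof -
  have "hl_bracket L (hl_bracket L x y) (hl_twist L z) = - hl_bracket L (hl_twist L z) (hl_bracket L x y)"
    by (rule bracket_skew)
  moreover have "hl_bracket L (hl_twist L y) (hl_bracket L z x) = - hl_bracket L (hl_twist L y) (hl_bracket L x z)"
    using bracket_skew[of z x] additive.minus[OF additive_if_linear[OF bracket_linear_right]]
    by metis
  ultimately show ?thesis
    using hom_jacobi[of x y z] by (simp add: add_eq_0_iff2 diff_eq_eq)
qed

text \<open>A representation of a Hom-Lie algebra on an abelian group with twist
  \<open>\<beta>\<close>; \<open>action_bracket\<close> is the Hom-version of the commutator rule
  for representations.\<close>

locale hom_action = multiplicative_hom_lie_algebra L
  for L :: "('k::field, 'a::ab_group_add) hom_lie" +
  fixes A :: "'a \<Rightarrow> 'b \<Rightarrow> 'b::ab_group_add" and \<beta> :: "'b \<Rightarrow> 'b"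
  assumes additive_action: "additive (A x)"
    and twist_action: "\<beta> (A x v) = A (hl_twist L x) (\<beta> v)"
    and additive_twist: "additive \<beta>"
    and action_bracket: "A (hl_bracket L x y) (\<beta> v) =
      A (hl_twist L x) (A y v) - A (hl_twist L y) (A x v)"
begin

abbreviation "\<alpha> \<equiv> hl_twist L"
abbreviation "br \<equiv> hl_bracket L"

lemma lie_act_twist: "lie_act L f (\<alpha> x) (map \<alpha> ys) = lie_act L (\<lambda>zs. f (map \<alpha> zs)) x ys"
  by (rule lie_act_map) (simp_all add: twist_bracket)

lemma loday_twist:
  "loday_coboundary L A g h (map \<alpha> ys) =
    loday_coboundary L (\<lambda>x. A (\<alpha> x)) (\<lambda>zs. g (map \<alpha> zs)) (\<lambda>zs. h (map \<alpha> zs)) ys"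
  by (rule loday_map) (simp_all add: twist_bracket)

text \<open>Lie derivatives commute up to the bracket. Terms in which \<open>x\<close> and
  \<open>y\<close> meet different entries agree in both orders; when they meet the same entry, the
  Hom-Leibniz rule leaves the bracket with \<open>br x y\<close>. The inner operator takes a twisted
  element since the outer one has already twisted the remaining entries.\<close>

lemma lie_act_lie_act:
  assumes "slot_linear (hl_scale L) s' k"
  shows "lie_act L (lie_act L k (\<alpha> x)) y zs =
    lie_act L (lie_act L k (\<alpha> y)) x zs + lie_act L k (br x y) (map \<alpha> zs)"
  using assms
proof (induction zs arbitrary: k)
  case (Cons z zs)
  have "k (br (\<alpha> x) (br y z) # ws) = k (br (br x y) (\<alpha> z) # ws) + k (br (\<alpha> y) (br x z) # ws)" for ws
    unfolding hom_jacobi_left[of x y z]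
    by (rule additive.add[OF additive_if_linear[OF slot_linear_hd[OF Cons.prems]]])
  then show ?case
    using Cons.IH[OF slot_linear_Cons[OF Cons.prems], of "\<alpha> (\<alpha> z)"]
    by (simp add: lie_act_add twist_bracket lie_act_twist comp_def
        flip: lie_act_twist[where x = x] lie_act_twist[where x = y])
qed simp

text \<open>
  The pair \<open>(A x \<circ> g - lie_act L h x, A (\<alpha> x) \<circ> h - lie_act L k (\<alpha> x))\<close> is the Lie derivative of
  \<open>(g, h)\<close> along \<open>x\<close>, and the right-hand side is the Lie derivative of the coboundary.
\<close>

lemma loday_lie_derivative:
  assumes "slot_linear (hl_scale L) s' k"
    and "\<And>zs. \<beta> (g zs) = h (map \<alpha> zs)"
  shows "loday_coboundary L (\<lambda>x. A (\<alpha> x)) (\<lambda>zs. A x (g zs) - lie_act L h x zs)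
      (\<lambda>zs. A (\<alpha> x) (h zs) - lie_act L k (\<alpha> x) zs) ys =
    A (\<alpha> x) (loday_coboundary L A g h ys) - lie_act L (loday_coboundary L A h k) x ys"
  using assms
proof (induction ys arbitrary: g h k)
  case Nil
  then show ?case by (simp add: additive.zero[OF additive_action])
next
  case (Cons y ys)
  note add = additive.add[OF additive_action] and diff = additive.diff[OF additive_action]
  let ?g = "\<lambda>zs. g (y # zs)" and ?h = "\<lambda>zs. h (\<alpha> y # zs)" and ?k = "\<lambda>zs. k (\<alpha> (\<alpha> y) # zs)"
  have IH: "loday_coboundary L (\<lambda>x. A (\<alpha> x)) (\<lambda>zs. A x (?g zs) - lie_act L ?h x zs)
      (\<lambda>zs. A (\<alpha> x) (?h zs) - lie_act L ?k (\<alpha> x) zs) ys =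
    A (\<alpha> x) (loday_coboundary L A ?g ?h ys) - lie_act L (loday_coboundary L A ?h ?k) x ys"
    by (rule Cons.IH) (simp_all add: slot_linear_Cons Cons.prems)
  \<comment> \<open>Separates the term with \<open>br x y\<close> from the Lie derivative of the
    contracted pair, to which the induction hypothesis applies.\<close>
  have rearr: "a - (b + c) = (a - c) - b" for a b c :: 'b
    by simp
  have "loday_coboundary L (\<lambda>x. A (\<alpha> x)) (\<lambda>zs. A x (g (y # zs)) - lie_act L h x (y # zs))
      (\<lambda>zs. A (\<alpha> x) (h (\<alpha> y # zs)) - lie_act L k (\<alpha> x) (\<alpha> y # zs)) ys =
    A (\<alpha> x) (loday_coboundary L A ?g ?h ys) - lie_act L (loday_coboundary L A ?h ?k) x ys -
    loday_coboundary L A (\<lambda>zs. h (br x y # zs)) (\<lambda>zs. k (\<alpha> (br x y) # zs)) (map \<alpha> ys)"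
    unfolding lie_act.simps rearr loday_twist twist_bracket
    by (subst loday_diff[OF additive_action]) (simp only: IH)
  then show ?case
    \<comment> \<open>What remains splits in two: the terms in \<open>k\<close> match by the
      commutation of Lie derivatives, and the double actions on \<open>g ys\<close> by
      \<open>action_bracket\<close>, because \<open>h (map \<alpha> ys)\<close> is
      \<open>\<beta> (g ys)\<close>.\<close>
    using lie_act_lie_act[OF Cons.prems(1), of x y ys] action_bracket[of x y "g ys"]
    by (simp add: diff Cons.prems(2) lie_act_diff lie_act_comp[OF additive_action])
qed

text \<open>At \<open>x # xs\<close>, the head part of the outer coboundary is the Lie derivative
  along \<open>x\<close> of the inner coboundary. By the recursion, the contracted inner coboundary
  is the Lie derivative of \<open>(g, h)\<close> minus the coboundary of the contractions. The
  coboundary of the former cancels the head part by \<open>loday_lie_derivative\<close>; that of the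
  latter vanishes by induction.\<close>

lemma loday_loday:
  assumes "slot_linear (hl_scale L) s' k"
    and "\<And>zs. \<beta> (g zs) = h (map \<alpha> zs)" and "\<And>zs. \<beta> (h zs) = k (map \<alpha> zs)"
  shows "loday_coboundary L (\<lambda>x. A (\<alpha> x)) (loday_coboundary L A g h) (loday_coboundary L A h k) xs = 0"
  using assms
proof (induction xs arbitrary: g h k)
  case (Cons x xs)
  let ?g = "\<lambda>zs. g (x # zs)" and ?h = "\<lambda>zs. h (\<alpha> x # zs)" and ?k = "\<lambda>zs. k (\<alpha> (\<alpha> x) # zs)"
  have "loday_coboundary L (\<lambda>x. A (\<alpha> x)) (loday_coboundary L A ?g ?h) (loday_coboundary L A ?h ?k) xs = 0"
    by (rule Cons.IH) (simp_all add: slot_linear_Cons Cons.prems)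
  then have "loday_coboundary L (\<lambda>x. A (\<alpha> x)) (\<lambda>zs. loday_coboundary L A g h (x # zs))
      (\<lambda>zs. loday_coboundary L A h k (\<alpha> x # zs)) xs =
    A (\<alpha> x) (loday_coboundary L A g h xs) - lie_act L (loday_coboundary L A h k) x xs"
    unfolding loday_coboundary.simps
    by (subst loday_diff[OF additive_action])
      (simp only: loday_lie_derivative[where g = g and h = h, OF Cons.prems(1,2)] diff_0_right)
  then show ?case
    by (simp only: loday_coboundary.simps(2)[where A = "\<lambda>x. A (\<alpha> x)"] diff_self)
qed simp

lemma twist_loday:
  assumes "\<And>zs. \<beta> (g zs) = h (map \<alpha> zs)" and "\<And>zs. \<beta> (h zs) = k (map \<alpha> zs)"
  shows "\<beta> (loday_coboundary L A g h xs) = loday_coboundary L A h k (map \<alpha> xs)"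
  unfolding loday_twist loday_comp[where F = \<beta> and A' = "\<lambda>x. A (\<alpha> x)", OF additive_twist twist_action]
    assms ..

end

section \<open>The explicit formula\<close>

lemma (in vector_space) scale_power_neg_one_Suc: "scale ((-1) ^ Suc i) v = - scale ((-1) ^ i) v"
  by simp

lemma nths_Cons_0: "nths (x # xs) (- {0}) = xs"
  by (simp add: nths_Cons nths_all)

lemma nths_Cons_Suc: "nths (x # xs) (- {Suc i}) = x # nths xs (- {i})"
proof -
  have "{j. Suc j \<in> - {Suc i}} = - {i}" by auto
  then show ?thesis by (simp add: nths_Cons)
qed

lemma nths_Cons_0_Suc: "nths (x # xs) (- {0, Suc j}) = nths xs (- {j})"
proof -
  have "{k. Suc k \<in> - {0, Suc j}} = - {j}" by auto
  then show ?thesis by (simp add: nths_Cons)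
qed

lemma nths_Cons_Suc_Suc: "nths (x # xs) (- {Suc i, Suc j}) = x # nths xs (- {i, j})"
proof -
  have "{k. Suc k \<in> - {Suc i, Suc j}} = - {i, j}" by auto
  then show ?thesis by (simp add: nths_Cons)
qed

text \<open>The first sum collects the brackets with the head of the list, the second the brackets
  within its tail.\<close>

lemma sum_pairs_Suc:
  fixes F :: "nat \<Rightarrow> nat \<Rightarrow> 'b::comm_monoid_add"
  shows "(\<Sum>(i, j)\<in>{(i, j). i < j \<and> j < Suc n}. F i j) =
    (\<Sum>j<n. F 0 (Suc j)) + (\<Sum>(i, j)\<in>{(i, j). i < j \<and> j < n}. F (Suc i) (Suc j))"
proof -
  have fin: "finite {(i, j). i < j \<and> j < n}"
    by (rule finite_subset[of _ "{..<n} \<times> {..<n}"]) auto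
  have "p \<in> (\<lambda>j. (0, Suc j)) ` {..<n} \<union> map_prod Suc Suc ` {(i, j). i < j \<and> j < n}"
    if p: "p \<in> {(i, j). i < j \<and> j < Suc n}" for p
  proof -
    obtain i j where "p = (i, j)" "i < j" "j < Suc n"
      using p by blast
    moreover from this obtain j' where "j = Suc j'"
      by (cases j) auto
    ultimately have "p = (i, Suc j')" "i < Suc j'" "j' < n"
      by auto
    then show ?thesis by (cases i) auto
  qed
  then have eq: "{(i, j). i < j \<and> j < Suc n} =
    (\<lambda>j. (0, Suc j)) ` {..<n} \<union> map_prod Suc Suc ` {(i, j). i < j \<and> j < n}"
    by auto
  have "inj_on (map_prod Suc Suc) X" for X
    by (auto simp: inj_on_def)
  then show ?thesis
    unfolding eq using fin
    by (subst sum.union_disjoint) (auto simp: sum.reindex inj_on_def case_prod_beta)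
qed

text \<open>The sign \<open>(-1) ^ j\<close> is the cost of moving the bracket from the front to
  position \<open>j\<close>, where \<open>lie_act\<close> has it.\<close>

lemma (in vector_space) sum_bracket_eq_lie_act:
  assumes "slot_skew h"
  shows "(\<Sum>j<length ys. scale ((-1) ^ j)
      (h (hl_bracket L x (ys ! j) # map (hl_twist L) (nths ys (- {j}))))) = lie_act L h x ys"
  using assms
proof (induction ys arbitrary: h)
  case (Cons y ys)
  have "scale ((-1) ^ Suc j)
      (h (hl_bracket L x (ys ! j) # hl_twist L y # map (hl_twist L) (nths ys (- {j})))) =
    scale ((-1) ^ j)
      (h (hl_twist L y # hl_bracket L x (ys ! j) # map (hl_twist L) (nths ys (- {j}))))" for j
    unfolding scale_power_neg_one_Suc slot_skew_hd[OF Cons.prems, of "hl_bracket L x (ys ! j)"]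
    by simp
  then show ?case
    using Cons.IH[OF slot_skew_Cons[OF Cons.prems]]
    by (simp add: sum.lessThan_Suc_shift nths_Cons_0 nths_Cons_Suc del: sum.lessThan_Suc power_Suc)
qed simp

lemma (in vector_space) explicit_coboundary_eq_loday:
  assumes "slot_skew h"
  shows "(\<Sum>i<length xs. scale ((-1) ^ i) (A (xs ! i) (g (nths xs (- {i}))))) +
      (\<Sum>(i, j)\<in>{(i, j). i < j \<and> j < length xs}. scale ((-1) ^ (i + j))
        (h (hl_bracket L (xs ! i) (xs ! j) # map (hl_twist L) (nths xs (- {i, j}))))) =
    loday_coboundary L A g h xs"
  using assms
proof (induction xs arbitrary: g h)
  case (Cons x xs)
  let ?\<alpha> = "hl_twist L"
  \<comment> \<open>For pairs in the tail both indices shift by one, so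
    \<open>(-1) ^ (i + j)\<close> is unchanged; the minus sign of the recursion comes from moving
    the bracket behind the twisted head. In the first sum it comes from the shift of the single
    index.\<close>
  have swap: "scale ((-1) ^ (i + j))
      (h (hl_bracket L (xs ! i) (xs ! j) # ?\<alpha> x # map ?\<alpha> (nths xs (- {i, j})))) =
    - scale ((-1) ^ (i + j))
      (h (?\<alpha> x # hl_bracket L (xs ! i) (xs ! j) # map ?\<alpha> (nths xs (- {i, j}))))" for i j
    unfolding slot_skew_hd[OF Cons.prems, of "hl_bracket L (xs ! i) (xs ! j)"] by simp
  have e1: "(\<Sum>i<length (x # xs). scale ((-1) ^ i) (A ((x # xs) ! i) (g (nths (x # xs) (- {i}))))) =
    A x (g xs) - (\<Sum>i<length xs. scale ((-1) ^ i) (A (xs ! i) (g (x # nths xs (- {i})))))"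
    by (simp add: sum.lessThan_Suc_shift nths_Cons_0 nths_Cons_Suc sum_negf del: sum.lessThan_Suc)
  have e2: "(\<Sum>(i, j)\<in>{(i, j). i < j \<and> j < length (x # xs)}. scale ((-1) ^ (i + j))
        (h (hl_bracket L ((x # xs) ! i) ((x # xs) ! j) # map ?\<alpha> (nths (x # xs) (- {i, j}))))) =
    - lie_act L h x xs - (\<Sum>(i, j)\<in>{(i, j). i < j \<and> j < length xs}. scale ((-1) ^ (i + j))
        (h (?\<alpha> x # hl_bracket L (xs ! i) (xs ! j) # map ?\<alpha> (nths xs (- {i, j})))))"
    unfolding list.size add_0_right add_Suc_right sum_pairs_Suc nths_Cons_0_Suc nths_Cons_Suc_Suc
      nth_Cons_0 nth_Cons_Suc list.map add_0_left scale_power_neg_one_Suc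
      sum_negf sum_bracket_eq_lie_act[OF Cons.prems] case_prod_beta
    by (simp add: swap sum_negf)
  show ?case
    unfolding e1 e2 loday_coboundary.simps Cons.IH[OF slot_skew_Cons[OF Cons.prems], symmetric]
    by (simp add: algebra_simps)
qed simp

section \<open>Cochains of a morphism\<close>

locale hom_lie_map = dom: multiplicative_hom_lie_algebra L + cod: multiplicative_hom_lie_algebra L'
  for L :: "('k::field, 'a::ab_group_add) hom_lie" and L' :: "('k, 'b::ab_group_add) hom_lie" +
  fixes \<phi> :: "'a \<Rightarrow> 'b"
  assumes morphism: "hom_lie_morphism L L' \<phi>"
begin

lemma morphism_linear: "Vector_Spaces.linear (hl_scale L) (hl_scale L') \<phi>"
  and morphism_bracket: "hl_bracket L' (\<phi> x) (\<phi> y) = \<phi> (hl_bracket L x y)"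
  and morphism_twist: "hl_twist L' (\<phi> x) = \<phi> (hl_twist L x)"
  using morphism by (auto simp: hom_lie_morphism_def fun_eq_iff)

text \<open>The codomain as a representation of \<open>L\<close> through \<phi> and the
  \<open>m\<close>-th power of the twist; the coboundary in degree \<open>n\<close> uses
  \<open>m = n - 1\<close>.\<close>

definition action :: "nat \<Rightarrow> 'a \<Rightarrow> 'b \<Rightarrow> 'b" where
  "action m x v = hl_bracket L' (\<phi> ((hl_twist L ^^ m) x)) v"

lemma linear_twist_power: "Vector_Spaces.linear (hl_scale L) (hl_scale L) (hl_twist L ^^ m)"
proof (induction m)
  case 0
  show ?case using dom.vector_space_axioms by (simp add: Vector_Spaces.linear_iff)
next
  case (Suc m)
  then show ?case using linear_comp[OF Suc dom.twist_linear] by (simp add: comp_def)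
qed

lemma linear_action: "Vector_Spaces.linear (hl_scale L') (hl_scale L') (action m x)"
  unfolding action_def by (rule cod.bracket_linear_right)

lemma linear_action_left: "Vector_Spaces.linear (hl_scale L) (hl_scale L') (\<lambda>x. action m x v)"
  unfolding action_def
  by (intro linear_comp[OF _ cod.bracket_linear_left] linear_comp[OF _ morphism_linear]
      linear_twist_power)

lemma action_Suc: "action (Suc m) = (\<lambda>x. action m (hl_twist L x))"
  by (simp add: action_def fun_eq_iff funpow_swap1)

lemma twist_power_bracket:
  "(hl_twist L ^^ m) (hl_bracket L x y) = hl_bracket L ((hl_twist L ^^ m) x) ((hl_twist L ^^ m) y)"
  by (induction m) (simp_all add: dom.twist_bracket)

text \<open>The rule \<open>action_bracket\<close> is the Hom-Leibniz rule of \<open>L'\<close> at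
  the images under \<open>\<phi>\<close> of the twisted elements.\<close>

sublocale hom_action L "action m" "hl_twist L'" for m
proof
  have "additive (action m x)" for x
    by (rule additive_if_linear[OF linear_action])
  then show "action m x (u + v) = action m x u + action m x v" for x u v
    by (rule additive.add)
  show "hl_twist L' (action m x v) = action m (hl_twist L x) (hl_twist L' v)" for x v
    by (simp add: action_def cod.twist_bracket morphism_twist funpow_swap1)
  show "hl_twist L' (u + v) = hl_twist L' u + hl_twist L' v" for u v
    by (rule additive.add[OF additive_if_linear[OF cod.twist_linear]])
  show "action m (hl_bracket L x y) (hl_twist L' v) =
    action m (hl_twist L x) (action m y v) - action m (hl_twist L y) (action m x v)" for x y v
    unfolding action_def twist_power_bracket
    using cod.hom_jacobi_left[of "\<phi> ((hl_twist L ^^ m) x)" "\<phi> ((hl_twist L ^^ m) y)" v]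
    by (simp add: morphism_twist morphism_bracket funpow_swap1)
qed

section \<open>The spaces of cochains along a morphism and their coboundary\<close>

lemma cochain_eq_0: "f \<in> hl_cochains L L' n \<Longrightarrow> length xs \<noteq> n \<Longrightarrow> f xs = 0"
  by (simp add: hl_cochains_def)

text \<open>The conditions can be stated without lengths since \<open>f\<close> vanishes off length
  \<open>n\<close> and the twist fixes \<open>0\<close>.\<close>

lemma mem_cochains_iff:
  assumes "n \<ge> 1"
  shows "f \<in> hl_cochains L L' n \<longleftrightarrow> (\<forall>xs. length xs \<noteq> n \<longrightarrow> f xs = 0) \<and>
    slot_linear (hl_scale L) (hl_scale L') f \<and> slot_skew f \<and>
    (\<forall>xs. hl_twist L' (f xs) = f (map (hl_twist L) xs))"
  (is "?l \<longleftrightarrow> ?r")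
proof -
  have "?l \<longleftrightarrow> ?r" if 0: "\<And>xs. length xs \<noteq> n \<Longrightarrow> f xs = 0"
  proof -
    have "skew_symmetric n f \<longleftrightarrow> slot_skew f"
      using skew_symmetric_if_slot_skew slot_skew_if_skew_symmetric 0 by blast
    moreover have "(\<forall>xs. length xs = n \<longrightarrow> hl_twist L' (f xs) = f (map (hl_twist L) xs)) \<longleftrightarrow>
      (\<forall>xs. hl_twist L' (f xs) = f (map (hl_twist L) xs))"
      using 0 additive.zero[OF additive_twist] by (metis length_map)
    ultimately show ?thesis
      unfolding hl_cochains_def
      using assms 0
        multilinear_iff_slot_linear[OF dom.vector_space_axioms cod.vector_space_axioms 0]
      by simp
  qed
  then show ?thesis by (auto simp: hl_cochains_def)
qed

lemma cochains_0: "0 \<in> hl_cochains L L' n"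
proof (cases "n \<ge> 1")
  case True
  show ?thesis
    unfolding mem_cochains_iff[OF True]
    by (simp add: slot_linear_def slot_skew_def additive.zero[OF additive_twist]
        linear_0[OF dom.vector_space_axioms cod.vector_space_axioms])
qed (simp add: hl_cochains_def not_le)

lemma hl_coboundary_eq_loday:
  assumes "f \<in> hl_cochains L L' n" and "n \<ge> 1"
  shows "hl_coboundary L L' \<phi> n f = loday_coboundary L (action (n - 1)) f f"
proof
  fix xs
  show "hl_coboundary L L' \<phi> n f xs = loday_coboundary L (action (n - 1)) f f xs"
  proof (cases "length xs = Suc n")
    case True
    have "{0..n} = {..<Suc n}" "{(i, j). i < j \<and> j \<le> n} = {(i, j). i < j \<and> j < Suc n}"
      by auto
    then show ?thesis
      using cod.explicit_coboundary_eq_loday[where h = f and g = f and xs = xs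
          and A = "action (n - 1)" and L = L] assms True
      by (simp add: hl_coboundary_def mem_cochains_iff action_def)
  next
    case False
    then show ?thesis
      using loday_eq_0[where A = "action (n - 1)" and n = n and g = f and h = f, OF additive_action]
        cochain_eq_0[OF assms(1)]
      by (simp add: hl_coboundary_def)
  qed
qed

lemma hl_coboundary_0: "hl_coboundary L L' \<phi> 0 f = 0"
  by (simp add: hl_coboundary_def fun_eq_iff)

lemma hl_coboundary_mem:
  assumes f: "f \<in> hl_cochains L L' n"
  shows "hl_coboundary L L' \<phi> n f \<in> hl_cochains L L' (Suc n)"
proof (cases "n \<ge> 1")
  case True
  have f': "slot_linear (hl_scale L) (hl_scale L') f" "slot_skew f"
    "\<And>xs. hl_twist L' (f xs) = f (map (hl_twist L) xs)"
    using f mem_cochains_iff[OF True] by auto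
  have "loday_coboundary L (action (n - 1)) f f xs = 0" if "length xs \<noteq> Suc n" for xs
    by (rule loday_eq_0[where n = n, OF additive_action]) (use that cochain_eq_0[OF f] in auto)
  moreover have "slot_skew (loday_coboundary L (action (n - 1)) f f)"
    by (rule dom.slot_skew_loday[OF f'(2) f'(2) f'(1) additive_action])
  ultimately show ?thesis
    unfolding hl_coboundary_eq_loday[OF f True] mem_cochains_iff[of "Suc n", simplified]
    using dom.slot_linear_loday[OF f'(1) f'(1) linear_action linear_action_left]
      twist_loday[where g = f and h = f and k = f, OF f'(3) f'(3)]
    by blast
next
  case False
  then have "n = 0" by simp
  then show ?thesis by (simp add: hl_coboundary_0 cochains_0)
qed

lemma hl_coboundary_hl_coboundary:
  assumes f: "f \<in> hl_cochains L L' n"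
  shows "hl_coboundary L L' \<phi> (Suc n) (hl_coboundary L L' \<phi> n f) = 0"
proof (cases n)
  case 0
  \<comment> \<open>In degree \<open>0\<close> the inner coboundary is \<open>0\<close> by
    convention. Naturality under the zero map shows that the outer one sends it to
    \<open>0\<close>.\<close>
  have "(0 :: 'a list \<Rightarrow> 'b) \<in> hl_cochains L L' 1"
    by (rule cochains_0)
  then show ?thesis
    using loday_comp[where F = "\<lambda>_. 0" and A = "action 0" and A' = "action 0" and L = L and g = 0 and h = 0]
    by (simp add: 0 hl_coboundary_0 hl_coboundary_eq_loday fun_eq_iff additive_def
        additive.zero[OF additive_action] zero_fun_def)
next
  case (Suc m)
  then have "slot_linear (hl_scale L) (hl_scale L') f"
    "\<And>xs. hl_twist L' (f xs) = f (map (hl_twist L) xs)"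
    using f mem_cochains_iff[of n f] by auto
  \<comment> \<open>A cochain commutes with the twists, so it can serve as \<open>g\<close>,
    \<open>h\<close> and \<open>k\<close> at once. The outer operator acts by
    \<open>action (Suc m)\<close>, which is \<open>action m\<close> precomposed with the
    twist.\<close>
  from loday_loday[where g = f and h = f and k = f, OF this this(2)]
  show ?thesis
    using hl_coboundary_eq_loday[OF hl_coboundary_mem[OF f]] hl_coboundary_eq_loday[OF f]
    by (intro ext) (simp add: Suc action_Suc)
qed

section \<open>Linear structure on cochains\<close>

lemma hl_coboundary_add:
  assumes "f \<in> hl_cochains L L' n" and "g \<in> hl_cochains L L' n"
    and "f + g \<in> hl_cochains L L' n"
  shows "hl_coboundary L L' \<phi> n (f + g) = hl_coboundary L L' \<phi> n f + hl_coboundary L L' \<phi> n g"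
proof (cases "n \<ge> 1")
  case True
  show ?thesis
    unfolding assms[THEN hl_coboundary_eq_loday[OF _ True]]
    by (simp add: fun_eq_iff plus_fun_def loday_add[OF additive_action])
qed (simp add: hl_coboundary_0 not_le)

lemma hl_coboundary_scale:
  assumes "f \<in> hl_cochains L L' n"
    and "(\<lambda>xs. hl_scale L' a (f xs)) \<in> hl_cochains L L' n"
  shows "hl_coboundary L L' \<phi> n (\<lambda>xs. hl_scale L' a (f xs)) xs =
    hl_scale L' a (hl_coboundary L L' \<phi> n f xs)"
proof (cases "n \<ge> 1")
  case True
  have "action m x (hl_scale L' a v) = hl_scale L' a (action m x v)" for m x v
    using linear_action[of m x] by (simp add: Vector_Spaces.linear_iff)
  moreover have "additive (hl_scale L' a)"
    by unfold_locales (rule cod.scale_right_distrib)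
  ultimately show ?thesis
    unfolding assms[THEN hl_coboundary_eq_loday[OF _ True]]
    by (subst loday_comp[where F = "hl_scale L' a"]) auto
qed (simp add: hl_coboundary_0 not_le)

lemma hl_coboundary_diff:
  assumes "f \<in> hl_cochains L L' n" and "g \<in> hl_cochains L L' n"
    and "f - g \<in> hl_cochains L L' n"
  shows "hl_coboundary L L' \<phi> n (f - g) = hl_coboundary L L' \<phi> n f - hl_coboundary L L' \<phi> n g"
  using hl_coboundary_add[of "f - g" n g] assms by (simp add: algebra_simps)

lemma cochains_add:
  assumes "f \<in> hl_cochains L L' n" and "g \<in> hl_cochains L L' n"
  shows "f + g \<in> hl_cochains L L' n"
proof (cases "n \<ge> 1")
  case True
  note add = additive.add[OF additive_twist]
  have "slot_skew (f + g)" if "slot_skew f" "slot_skew g"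
    unfolding slot_skew_def
  proof (intro allI)
    fix as x y bs
    show "(f + g) (as @ x # y # bs) = - (f + g) (as @ y # x # bs)"
      unfolding plus_fun_apply slot_skewD[OF that(1), of as x y bs] slot_skewD[OF that(2), of as x y bs]
      by simp
  qed
  then show ?thesis
    using assms unfolding mem_cochains_iff[OF True]
    by (auto simp: slot_linear_def add intro: linear_plus)
qed (use assms in \<open>simp add: hl_cochains_def not_le\<close>)

lemma cochains_scale:
  assumes "f \<in> hl_cochains L L' n"
  shows "(\<lambda>xs. hl_scale L' a (f xs)) \<in> hl_cochains L L' n"
proof (cases "n \<ge> 1")
  case True
  have "slot_skew (\<lambda>xs. hl_scale L' a (f xs))" if "slot_skew f"
    unfolding slot_skew_def
  proof (intro allI)
    fix as x y bs
    show "hl_scale L' a (f (as @ x # y # bs)) = - hl_scale L' a (f (as @ y # x # bs))"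
      unfolding slot_skewD[OF that, of as x y bs] by simp
  qed
  moreover have lin: "Vector_Spaces.linear (hl_scale L') (hl_scale L') (hl_scale L' a)"
    using cod.vector_space_axioms
    by (simp add: Vector_Spaces.linear_iff cod.scale_right_distrib mult.commute)
  moreover have "hl_twist L' (hl_scale L' a v) = hl_scale L' a (hl_twist L' v)" for v
    using cod.twist_linear by (simp add: Vector_Spaces.linear_iff)
  ultimately show ?thesis
    using assms unfolding mem_cochains_iff[OF True]
    by (auto simp: slot_linear_def intro: linear_comp[OF _ lin])
qed (use assms in \<open>simp add: hl_cochains_def not_le\<close>)

lemma cochains_diff:
  assumes "f \<in> hl_cochains L L' n" and "g \<in> hl_cochains L L' n"
  shows "f - g \<in> hl_cochains L L' n"
proof -
  have "f - g = f + (\<lambda>xs. hl_scale L' (- 1) (g xs))"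
    by (simp add: fun_eq_iff)
  then show ?thesis using cochains_add[OF assms(1) cochains_scale[OF assms(2)]] by (simp only:)
qed

lemma morphism_twist_power: "\<phi> ((hl_twist L ^^ m) x) = (hl_twist L' ^^ m) (\<phi> x)"
  by (induction m) (simp_all flip: morphism_twist)

end

text \<open>Makes the cochains of a single algebra the case of the identity morphism, so that all
  results on \<open>hom_lie_map\<close> apply to the first two components.\<close>

lemma (in multiplicative_hom_lie_algebra) hom_lie_map_id: "hom_lie_map L L id"
  by unfold_locales (auto simp: hom_lie_morphism_def Vector_Spaces.linear_iff vector_space_axioms)

section \<open>Composition with the morphism on either side as a chain map\<close>

context hom_lie_map
begin

lemma comp_mem_cochains:
  assumes "f \<in> hl_cochains L L n" and "n \<ge> 1"
  shows "\<phi> \<circ> f \<in> hl_cochains L L' n"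
proof -
  interpret D: hom_lie_map L L id by (rule dom.hom_lie_map_id)
  note minus = additive.minus[OF additive_if_linear[OF morphism_linear]]
  have "slot_skew (\<phi> \<circ> f)" if "slot_skew f"
    unfolding slot_skew_def comp_def
  proof (intro allI)
    fix as x y bs
    show "\<phi> (f (as @ x # y # bs)) = - \<phi> (f (as @ y # x # bs))"
      unfolding slot_skewD[OF that, of as x y bs] by (rule minus)
  qed
  then show ?thesis
    using assms(1) unfolding mem_cochains_iff[OF assms(2)] D.mem_cochains_iff[OF assms(2)]
    by (auto simp: slot_linear_def morphism_twist additive.zero[OF additive_if_linear[OF morphism_linear]]
        intro: linear_comp[OF _ morphism_linear])
qed

lemma diamond_mem_cochains:
  assumes "f \<in> hl_cochains L' L' n" and "n \<ge> 1"
  shows "diamond f \<phi> \<in> hl_cochains L L' n"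
proof -
  interpret C: hom_lie_map L' L' id by (rule cod.hom_lie_map_id)
  have "slot_skew (diamond f \<phi>)" if "slot_skew f"
    unfolding slot_skew_def diamond_def map_append list.map
    using slot_skewD[OF that] by blast
  moreover have "slot_linear (hl_scale L) (hl_scale L') (diamond f \<phi>)"
    if "slot_linear (hl_scale L') (hl_scale L') f"
    using that by (auto simp: slot_linear_def diamond_def intro: linear_comp[OF morphism_linear])
  ultimately show ?thesis
    using assms(1) unfolding mem_cochains_iff[OF assms(2)] C.mem_cochains_iff[OF assms(2)]
    by (auto simp: diamond_def morphism_twist comp_def)
qed

text \<open>Naturality in the coefficients: \<open>\<phi>\<close> intertwines the action of
  \<open>L\<close> on itself with its action on \<open>L'\<close>.\<close>

lemma hl_coboundary_comp:
  assumes "f \<in> hl_cochains L L n" and "n \<ge> 1"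
  shows "hl_coboundary L L' \<phi> n (\<phi> \<circ> f) = \<phi> \<circ> hl_coboundary L L id n f"
proof -
  interpret D: hom_lie_map L L id by (rule dom.hom_lie_map_id)
  have "\<phi> (D.action m x v) = action m x (\<phi> v)" for m x v
    by (simp add: action_def D.action_def morphism_bracket)
  then show ?thesis
    unfolding hl_coboundary_eq_loday[OF comp_mem_cochains[OF assms] assms(2)]
      D.hl_coboundary_eq_loday[OF assms]
    by (intro ext) (simp add: comp_def
        loday_comp[where F = \<phi> and A' = "action (n - 1)", OF additive_if_linear[OF morphism_linear]])
qed

text \<open>Naturality in the arguments: since \<open>\<phi>\<close> commutes with powers of the
  twists, the action of \<open>L\<close> on \<open>L'\<close> is the pullback along
  \<open>\<phi>\<close> of the action of \<open>L'\<close> on itself.\<close>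

lemma hl_coboundary_diamond:
  assumes "f \<in> hl_cochains L' L' n" and "n \<ge> 1"
  shows "hl_coboundary L L' \<phi> n (diamond f \<phi>) = diamond (hl_coboundary L' L' id n f) \<phi>"
proof -
  interpret C: hom_lie_map L' L' id by (rule cod.hom_lie_map_id)
  have "C.action m (\<phi> x) = action m x" for m x
    by (simp add: fun_eq_iff action_def C.action_def morphism_twist_power)
  then show ?thesis
    unfolding hl_coboundary_eq_loday[OF diamond_mem_cochains[OF assms] assms(2)]
      C.hl_coboundary_eq_loday[OF assms]
    by (intro ext) (simp add: diamond_def loday_map[where \<psi> = \<phi>, OF morphism_bracket morphism_twist])
qed

section \<open>The mapping cone of the chain map \<open>defect\<close>\<close>

definition defect :: "('a list \<Rightarrow> 'a) \<Rightarrow> ('b list \<Rightarrow> 'b) \<Rightarrow> 'a list \<Rightarrow> 'b" where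
  "defect f1 f2 = (\<phi> \<circ> f1) - diamond f2 \<phi>"

lemma morphism_coboundary_eq:
  "morphism_coboundary L L' \<phi> n (f1, f2, f3) =
    (hl_coboundary L L id n f1, hl_coboundary L' L' id n f2,
     hl_coboundary L L' \<phi> (n - 1) f3 + (\<lambda>xs. hl_scale L' ((-1) ^ (n - 1)) (defect f1 f2 xs)))"
  by (simp add: morphism_coboundary_def defect_def fun_eq_iff)

lemma defect_mem_cochains:
  assumes "f1 \<in> hl_cochains L L n" and "f2 \<in> hl_cochains L' L' n" and "n \<ge> 1"
  shows "defect f1 f2 \<in> hl_cochains L L' n"
  using assms by (simp add: defect_def cochains_diff comp_mem_cochains diamond_mem_cochains)

lemma hl_coboundary_defect:
  assumes "f1 \<in> hl_cochains L L n" and "f2 \<in> hl_cochains L' L' n" and "n \<ge> 1"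
  shows "hl_coboundary L L' \<phi> n (defect f1 f2) =
    defect (hl_coboundary L L id n f1) (hl_coboundary L' L' id n f2)"
  using assms
  by (simp add: defect_def hl_coboundary_diff cochains_diff comp_mem_cochains diamond_mem_cochains
      hl_coboundary_comp hl_coboundary_diamond)

lemma morphism_coboundary_mem:
  assumes "n \<ge> 1" and "c \<in> morphism_cochains L L' n"
  shows "morphism_coboundary L L' \<phi> n c \<in> morphism_cochains L L' (n + 1)"
proof -
  obtain f1 f2 f3 where c: "c = (f1, f2, f3)" by (cases c)
  have f: "f1 \<in> hl_cochains L L n" "f2 \<in> hl_cochains L' L' n" "f3 \<in> hl_cochains L L' (n - 1)"
    using assms(2) by (auto simp: c morphism_cochains_def)
  have "hl_coboundary L L' \<phi> (n - 1) f3 \<in> hl_cochains L L' n"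
    using hl_coboundary_mem[OF f(3)] assms(1) by simp
  then show ?thesis
    using hom_lie_map.hl_coboundary_mem[OF dom.hom_lie_map_id f(1)]
      hom_lie_map.hl_coboundary_mem[OF cod.hom_lie_map_id f(2)]
      cochains_add[OF _ cochains_scale[OF defect_mem_cochains[OF f(1,2) assms(1)]]]
    by (simp add: c morphism_coboundary_eq morphism_cochains_def)
qed

lemma morphism_coboundary_morphism_coboundary:
  assumes "n \<ge> 1" and "c \<in> morphism_cochains L L' n"
  shows "morphism_coboundary L L' \<phi> (n + 1) (morphism_coboundary L L' \<phi> n c) = 0"
proof -
  obtain f1 f2 f3 where c: "c = (f1, f2, f3)" by (cases c)
  have f: "f1 \<in> hl_cochains L L n" "f2 \<in> hl_cochains L' L' n" "f3 \<in> hl_cochains L L' (n - 1)"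
    using assms(2) by (auto simp: c morphism_cochains_def)
  obtain m where n: "n = Suc m" using assms(1) by (cases n) auto
  let ?s = "hl_scale L' ((-1) ^ (n - 1))"
  have d: "defect f1 f2 \<in> hl_cochains L L' n" "(\<lambda>xs. ?s (defect f1 f2 xs)) \<in> hl_cochains L L' n"
    using defect_mem_cochains[OF f(1,2) assms(1)] by (simp_all add: cochains_scale)
  have d3: "hl_coboundary L L' \<phi> (n - 1) f3 \<in> hl_cochains L L' n"
    using hl_coboundary_mem[OF f(3)] assms(1) by simp
  have "hl_coboundary L L' \<phi> n (hl_coboundary L L' \<phi> (n - 1) f3) = 0"
    using hl_coboundary_hl_coboundary[OF f(3)] assms(1) by simp
  then have "hl_coboundary L L' \<phi> n
      (hl_coboundary L L' \<phi> (n - 1) f3 + (\<lambda>xs. ?s (defect f1 f2 xs))) =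
    (\<lambda>xs. ?s (defect (hl_coboundary L L id n f1) (hl_coboundary L' L' id n f2) xs))"
    using hl_coboundary_add[OF d3 d(2) cochains_add[OF d3 d(2)]] hl_coboundary_scale[OF d]
      hl_coboundary_defect[OF f(1,2) assms(1)]
    by (simp add: fun_eq_iff)
  \<comment> \<open>In the third component, the coboundary of the scaled defect carries the sign
    \<open>(-1) ^ (n - 1)\<close>, whereas the defect of the coboundaries enters with
    \<open>(-1) ^ n\<close>; they cancel by \<open>hl_coboundary_defect\<close>.\<close>
  then show ?thesis
    using hom_lie_map.hl_coboundary_hl_coboundary[OF dom.hom_lie_map_id f(1)]
      hom_lie_map.hl_coboundary_hl_coboundary[OF cod.hom_lie_map_id f(2)]
    by (simp add: c morphism_coboundary_eq n zero_prod_def fun_eq_iff)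
qed

end

lemma vector_space_morphism_cochain_scale:
  assumes "vector_space (hl_scale L)" and "vector_space (hl_scale L')"
  shows "vector_space (morphism_cochain_scale L L')"
proof -
  interpret V: vector_space "hl_scale L" by fact
  interpret V': vector_space "hl_scale L'" by fact
  show ?thesis
    by unfold_locales
      (auto simp: morphism_cochain_scale_def fun_eq_iff V.scale_right_distrib V.scale_left_distrib
        V'.scale_right_distrib V'.scale_left_distrib)
qed

theorem lemma3p7:
  fixes L :: "('k::{alg_closed_field, field_char_0}, 'a::ab_group_add) hom_lie"
    and L' :: "('k, 'b::ab_group_add) hom_lie"
    and \<phi> :: "'a \<Rightarrow> 'b"
  assumes "multiplicative_hom_lie_algebra L"
    and "multiplicative_hom_lie_algebra L'"
    and "hom_lie_morphism L L' \<phi>"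
  shows "(\<forall>n\<ge>1. \<forall>c\<in>morphism_cochains L L' n.
      morphism_coboundary L L' \<phi> n c \<in> morphism_cochains L L' (n + 1) \<and>
      morphism_coboundary L L' \<phi> (n + 1) (morphism_coboundary L L' \<phi> n c) = 0) \<and>
    cochain_complex (morphism_cochain_scale L L') (morphism_cochains L L') (morphism_coboundary L L' \<phi>)"
proof -
  interpret hom_lie_map L L' \<phi>
    using assms by (simp add: hom_lie_map_def hom_lie_map_axioms_def)
  interpret D: hom_lie_map L L id by (rule dom.hom_lie_map_id)
  interpret C: hom_lie_map L' L' id by (rule cod.hom_lie_map_id)
  have vs: "vector_space (morphism_cochain_scale L L')"
    by (rule vector_space_morphism_cochain_scale[OF dom.vector_space_axioms cod.vector_space_axioms])
  interpret M: vector_space "morphism_cochain_scale L L'" by (rule vs)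
  have subspace: "M.subspace (morphism_cochains L L' n)" for n
    unfolding M.subspace_def
    by (auto simp: morphism_cochains_def morphism_cochain_scale_def zero_prod_def
        cochains_0 D.cochains_0 C.cochains_0 cochains_add D.cochains_add C.cochains_add
        cochains_scale D.cochains_scale C.cochains_scale)
  have add: "morphism_coboundary L L' \<phi> n (x + y) =
      morphism_coboundary L L' \<phi> n x + morphism_coboundary L L' \<phi> n y"
    if "x \<in> morphism_cochains L L' n" "y \<in> morphism_cochains L L' n" for n x y
  proof -
    obtain f1 f2 f3 g1 g2 g3 where xy: "x = (f1, f2, f3)" "y = (g1, g2, g3)"
      by (cases x, cases y) blast
    \<comment> \<open>The defect is the only term mixing components; it is additive in the first by
      linearity of \<open>\<phi>\<close> and pointwise in the second.\<close>
    have "defect (f1 + g1) (f2 + g2) = defect f1 f2 + defect g1 g2"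
      by (simp add: defect_def diamond_def fun_eq_iff
          additive.add[OF additive_if_linear[OF morphism_linear]])
    then show ?thesis
      using that
      by (simp add: xy morphism_cochains_def morphism_coboundary_eq hl_coboundary_add cochains_add
          D.hl_coboundary_add D.cochains_add C.hl_coboundary_add C.cochains_add
          fun_eq_iff cod.scale_right_distrib)
  qed
  have scale: "morphism_coboundary L L' \<phi> n (morphism_cochain_scale L L' a x) =
      morphism_cochain_scale L L' a (morphism_coboundary L L' \<phi> n x)"
    if "x \<in> morphism_cochains L L' n" for n a x
  proof -
    obtain f1 f2 f3 where x: "x = (f1, f2, f3)"
      by (cases x) blast
    have "defect (\<lambda>xs. hl_scale L a (f1 xs)) (\<lambda>xs. hl_scale L' a (f2 xs)) xs =
        hl_scale L' a (defect f1 f2 xs)" for xs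
      using morphism_linear
      by (simp add: defect_def diamond_def Vector_Spaces.linear_iff cod.scale_right_diff_distrib)
    then show ?thesis
      using that
      by (simp add: x morphism_cochains_def morphism_cochain_scale_def morphism_coboundary_eq
          hl_coboundary_scale cochains_scale D.hl_coboundary_scale D.cochains_scale
          C.hl_coboundary_scale C.cochains_scale fun_eq_iff cod.scale_right_distrib mult.commute)
  qed
  show ?thesis
    unfolding cochain_complex_def
    using morphism_coboundary_mem morphism_coboundary_morphism_coboundary vs subspace add scale
    by blast
qed

end
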